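(* Let $n$ be any nonnegative integer such that $n-1$ is divisible by $6$ (so $n\ge1$). There is a polytope $P\subseteq[0,1]^n$ such that $$P_I=L^2(P)\subsetneq\bigcap_{\mathcal{T}\in\mathbb{T}^\ell_{2^{(n-1)/6}}}\mathcal{T}(P),$$ where $\mathbb{T}^\ell_k$ denotes the set of branch-and-bound trees with at most $k$ leaves. In particular, there is a point $x\in P\setminus P_I$ such that no branch-and-bound tree of size at most $2^{(n-1)/6}$ separates $x$, while $L^2(P)=P_I$.
   Context: $[n]=\{1,\dots,n\}$. For a polytope $P\subseteq[0,1]^n$, $P_I:=\mathrm{conv}(P\cap\{0,1\}^n)$. A branch-and-bound tree $\mathcal{T}$ (on variables $x_1,\dots,x_n$) is a rooted binary tree in which each node has $0$ or $2$ children. Each node $v$ carries a set $C_v$ of branching constraints. The root has $C_{\mathrm{root}}=\emptyset$. If a node $v$ has two children, they are obtained by branching on a variable $x_j$, $j\in[n]$, not already branched on at an ancestor of $v$: one child has branching constraints $C_v\cup\{x_j=0\}$ and the other $C_v\cup\{x_j=1\}$. The size of $\mathcal{T}$ is its number of nodes. For a polytope $P$, the atom of $v$ is $P_v:=P\cap\{x:C_v\}$ (points of $P$ satisfying all constraints in $C_v$), and $\mathcal{T}(P):=\mathrm{conv}\big(\bigcup_{v\in\mathrm{leaves}(\mathcal{T})}P_v\big)$. $\mathcal{T}$ separates $x^*\in P\setminus P_I$ if $x^*\notin\mathcal{T}(P)$. Lift-and-project: $L(P):=\bigcap_{i\in[n]}\mathrm{conv}\big((P\cap\{x:x_i=0\})\cup(P\cap\{x:x_i=1\})\big)$,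 $L^0(P):=P$, and $L^k(P):=L(L^{k-1}(P))$ for $k\ge1$. *)

theory Defs
  imports "HOL-Analysis.Analysis"
begin

definition integer_hull :: "(real ^ 'n) set \<Rightarrow> (real ^ 'n) set" where
  "integer_hull P = convex hull (P \<inter> {x. \<forall>i. x $ i \<in> {0, 1}})"

definition lift_project :: "(real ^ 'n) set \<Rightarrow> (real ^ 'n) set" where
  "lift_project P =
     (\<Inter>i. convex hull ((P \<inter> {x. x $ i = 0}) \<union> (P \<inter> {x. x $ i = 1})))"

datatype 'n bb_tree = Leaf | Branch 'n "'n bb_tree" "'n bb_tree"

primrec num_leaves :: "'n bb_tree \<Rightarrow> nat" where
  "num_leaves Leaf = 1"
| "num_leaves (Branch j t0 t1) = num_leaves t0 + num_leaves t1"

primrec num_nodes :: "'n bb_tree \<Rightarrow> nat" where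
  "num_nodes Leaf = 1"
| "num_nodes (Branch j t0 t1) = 1 + num_nodes t0 + num_nodes t1"

text \<open>
  The pair \<open>(j, b)\<close> encodes the branching constraint \<open>x\<^sub>j = 0\<close> if \<open>b = False\<close> and
  \<open>x\<^sub>j = 1\<close> if \<open>b = True\<close>. In the next two functions, \<open>C\<close> is the constraint set of
  the node at which the given (sub)tree is rooted; it is empty for the root of the whole tree.
\<close>

primrec branches_fresh :: "('n \<times> bool) set \<Rightarrow> 'n bb_tree \<Rightarrow> bool" where
  "branches_fresh C Leaf \<longleftrightarrow> True"
| "branches_fresh C (Branch j t0 t1) \<longleftrightarrow>
     j \<notin> fst ` C \<and>
     branches_fresh (insert (j, False) C) t0 \<and> branches_fresh (insert (j, True) C) t1"

primrec leaf_constraints :: "('n \<times> bool) set \<Rightarrow> 'n bb_tree \<Rightarrow> ('n \<times> bool) set set" where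
  "leaf_constraints C Leaf = {C}"
| "leaf_constraints C (Branch j t0 t1) =
     leaf_constraints (insert (j, False) C) t0 \<union> leaf_constraints (insert (j, True) C) t1"

definition bb_trees :: "'n bb_tree set" where
  "bb_trees = {T. branches_fresh {} T}"

definition bb_trees_leaves :: "nat \<Rightarrow> 'n bb_tree set" where
  "bb_trees_leaves k = {T \<in> bb_trees. num_leaves T \<le> k}"

definition atom :: "(real ^ 'n) set \<Rightarrow> ('n \<times> bool) set \<Rightarrow> (real ^ 'n) set" where
  "atom P C = P \<inter> {x. \<forall>(j, b) \<in> C. x $ j = of_bool b}"

definition bb_relax :: "'n bb_tree \<Rightarrow> (real ^ 'n) set \<Rightarrow> (real ^ 'n) set" where
  "bb_relax T P = convex hull (\<Union>C \<in> leaf_constraints {} T. atom P C)"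

definition separates :: "'n bb_tree \<Rightarrow> (real ^ 'n) set \<Rightarrow> real ^ 'n \<Rightarrow> bool" where
  "separates T P x \<longleftrightarrow> x \<notin> bb_relax T P"

end

theory Submission
  imports Defs
begin

text \<open>
  Single out one coordinate \<open>y\<close> (the apex) and group the other \<open>N = n - 1\<close> coordinates into
  \<open>N / 2\<close> pairs. On each pair put the quadrilateral
  \<open>a, b \<ge> 0\<close>, \<open>2 a + b \<le> 2\<close>, \<open>a + 2 b \<le> 2\<close>.
  Its integer hull is the triangle \<open>a + b \<le> 1\<close>, but \<open>a + b\<close> reaches \<open>4/3\<close> at the vertex
  \<open>(2/3, 2/3)\<close>; fixing either variable to \<open>0\<close> or to \<open>1\<close> already enforces \<open>a + b \<le> 1\<close>.
  Link the pairs to \<open>y\<close> by one inequality that at \<open>y = 1\<close> asks for a total of at least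
  \<open>N / 2 + 1/8\<close>, and hence for at least one pair with \<open>a + b > 1\<close>.

  Lift-and-project handles all pairs in parallel: the first round yields \<open>a + b \<le> 1\<close> for every
  pair, after which \<open>y = 1\<close> is infeasible, and the second round yields \<open>y = 0\<close>. What remains
  is a product of triangles, which is integral (\<open>lift_project_2_eq_integer_hull\<close>).

  A branch-and-bound tree has to treat the pairs one after the other. An adversary keeps a point
  with \<open>y = 1\<close> in which every pair is still free, at \<open>(2/3, 2/3)\<close>, or has been fixed to
  \<open>(0, 1)\<close> or \<open>(1, 0)\<close>. Branching on a free pair leaves both children feasible, so the adversary
  can move to the child with fewer leaves; every other branching has a child that agrees with the
  current point. Each fixed pair thus costs the tree a factor of two in its number of leaves, and
  a tree with fewer than \<open>2 ^ (N / 2)\<close> leaves has a leaf whose atom contains a point with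
  \<open>y = 1\<close> (\<open>small_tree_has_adversary_leaf\<close>).

  That point depends on the tree, whereas one point must survive all small trees. The point with
  all coordinates \<open>1/4\<close> does: its pairs \<open>(1/4, 1/4)\<close> lie so far inside the triangle that it
  is a convex combination, with weight \<open>1/4\<close> on the adversary's point, of that point and a
  point of the integer hull, and no tree cuts off any point of the integer hull
  (\<open>unseparated_point_in_bb_relax\<close>).
\<close>

section \<open>Integer points in relaxations\<close>

lemma convex_lift_project: "convex (lift_project P)"
  unfolding lift_project_def by (intro convex_INT) auto

lemma lift_project_mono: "P \<subseteq> Q \<Longrightarrow> lift_project P \<subseteq> lift_project Q"
  unfolding lift_project_def by (intro INF_mono' hull_mono) auto

text \<open>
  A convex condition passes to the lift-and-project closure as soon as the two faces of a single
  coordinate satisfy it; this is how every cut below is derived.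
\<close>

lemma lift_project_subset_face_hull:
  assumes "convex K"
    and "\<And>x. x \<in> P \<Longrightarrow> x $ i = 0 \<Longrightarrow> x \<in> K"
    and "\<And>x. x \<in> P \<Longrightarrow> x $ i = 1 \<Longrightarrow> x \<in> K"
  shows "lift_project P \<subseteq> K"
proof -
  have "convex hull ((P \<inter> {x. x $ i = 0}) \<union> (P \<inter> {x. x $ i = 1})) \<subseteq> K"
    using assms by (intro hull_minimal) auto
  then show ?thesis unfolding lift_project_def by blast
qed

lemma integer_point_in_lift_project:
  assumes "x \<in> P" "\<forall>i. x $ i \<in> {0, 1}"
  shows "x \<in> lift_project P"
  unfolding lift_project_def
proof (rule INT_I)
  fix i
  have "x \<in> (P \<inter> {x. x $ i = 0}) \<union> (P \<inter> {x. x $ i = 1})"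
    using assms by auto
  then show "x \<in> convex hull ((P \<inter> {x. x $ i = 0}) \<union> (P \<inter> {x. x $ i = 1}))"
    by (rule hull_inc)
qed

lemma integer_hull_subset_lift_project_2: "integer_hull P \<subseteq> (lift_project ^^ 2) P"
  unfolding integer_hull_def
  by (intro hull_minimal)
    (auto simp: numeral_2_eq_2 convex_lift_project intro!: integer_point_in_lift_project)

text \<open>
  A 0/1 point follows its own coordinates down the tree, so branching never loses it.
\<close>

lemma integer_point_reaches_leaf:
  assumes "\<forall>i. x $ i \<in> {0, 1}" "\<forall>(j, b) \<in> C. x $ j = of_bool b"
  shows "\<exists>C' \<in> leaf_constraints C T. \<forall>(j, b) \<in> C'. x $ j = of_bool b"
  using assms(2)
proof (induction T arbitrary: C)
  case (Branch j t0 t1)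
  consider "x $ j = 0" | "x $ j = 1" using assms(1) by auto
  then show ?case
  proof cases
    case 1
    then have "\<forall>(i, b) \<in> insert (j, False) C. x $ i = of_bool b"
      using Branch.prems by simp
    from Branch.IH(1)[OF this] show ?thesis unfolding leaf_constraints.simps by blast
  next
    case 2
    then have "\<forall>(i, b) \<in> insert (j, True) C. x $ i = of_bool b"
      using Branch.prems by simp
    from Branch.IH(2)[OF this] show ?thesis unfolding leaf_constraints.simps by blast
  qed
qed auto

lemma integer_hull_subset_bb_relax: "integer_hull P \<subseteq> bb_relax T P"
  unfolding integer_hull_def bb_relax_def
proof (intro hull_mono subsetI)
  fix x assume "x \<in> P \<inter> {x. \<forall>i. x $ i \<in> {0, 1}}"
  then show "x \<in> (\<Union>C \<in> leaf_constraints {} T. atom P C)"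
    using integer_point_reaches_leaf[of x "{}" T] by (auto simp: atom_def)
qed

lemma num_leaves_pos: "0 < num_leaves T"
  by (induction T) auto

lemma num_leaves_le_num_nodes: "num_leaves T \<le> num_nodes T"
  by (induction T) auto

lemma num_leaves_eq_1: "num_leaves T \<le> 1 \<Longrightarrow> T = Leaf"
proof (cases T)
  case (Branch j t0 t1)
  moreover assume "num_leaves T \<le> 1"
  ultimately show ?thesis using num_leaves_pos[of t0] num_leaves_pos[of t1] by simp
qed

section \<open>The polytope\<close>

text \<open>
  Encoding the pairs by an involution whose only fixed point is the apex keeps all coordinates in
  the one index type and makes constraints on pairs symmetric for free: a constraint imposed at
  \<open>i\<close> is also imposed at \<open>mate i\<close>.
\<close>

locale paired_coordinates =
  fixes apex :: "'n::finite" and mate :: "'n \<Rightarrow> 'n"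
  assumes mate_mate [simp]: "mate (mate i) = i"
    and mate_fixed: "mate i = i \<longleftrightarrow> i = apex"
begin

lemma mate_apex [simp]: "mate apex = apex"
  using mate_fixed by blast

lemma mate_eq_apex [simp]: "mate i = apex \<longleftrightarrow> i = apex"
  by (metis mate_mate mate_apex)

lemma apex_eq_mate [simp]: "apex = mate i \<longleftrightarrow> i = apex"
  by (metis mate_eq_apex)

lemma mate_neq: "i \<noteq> apex \<Longrightarrow> mate i \<noteq> i"
  using mate_fixed by blast

lemma mate_eq_iff: "mate i = j \<longleftrightarrow> i = mate j"
  by auto

lemma sum_mate: "(\<Sum>i\<in>UNIV - {apex}. f (mate i)) = (\<Sum>i\<in>UNIV - {apex}. f i)"
  by (rule sum.reindex_bij_witness[where i = mate and j = mate]) auto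

lemma sum_pairs:
  fixes f :: "'n \<Rightarrow> real"
  shows "2 * (\<Sum>i\<in>UNIV - {apex}. f i) = (\<Sum>i\<in>UNIV - {apex}. f i + f (mate i))"
  by (simp add: sum.distrib sum_mate)

text \<open>
  With \<open>S\<close> the sum over the paired coordinates, the last inequality is
  \<open>(N / 2 + 1/4) y \<le> S + 1/8\<close> cleared of fractions. At \<open>y = 1\<close> it requires
  \<open>S \<ge> N / 2 + 1/8\<close>, which rules out \<open>a + b \<le> 1\<close> in all pairs. The constant \<open>1/8\<close> on
  the right admits \<open>y = 1/2\<close> when there are no pairs at all, so that the case \<open>n = 1\<close> is
  covered too.
\<close>

definition hard_polytope :: "(real ^ 'n) set" where
  "hard_polytope = {x. (\<forall>i. 0 \<le> x $ i \<and> x $ i \<le> 1) \<and>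
     (\<forall>i. i \<noteq> apex \<longrightarrow> 2 * x $ i + x $ mate i \<le> 2) \<and>
     (4 * real (card (UNIV - {apex})) + 2) * x $ apex \<le> 8 * (\<Sum>i\<in>UNIV - {apex}. x $ i) + 1}"

definition pair_polytope :: "(real ^ 'n) set" where
  "pair_polytope = {x. (\<forall>i. 0 \<le> x $ i \<and> x $ i \<le> 1) \<and>
     (\<forall>i. i \<noteq> apex \<longrightarrow> x $ i + x $ mate i \<le> 1) \<and> x $ apex = 0}"

lemma polytope_hard_polytope: "polytope hard_polytope"
proof -
  have pairs: "{x. 2 * x $ i + x $ mate i \<le> 2} =
      {x :: real ^ 'n. (2 *\<^sub>R axis i 1 + axis (mate i) 1) \<bullet> x \<le> 2}" for i
    by (simp add: inner_add_left inner_axis')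
  define c :: real where "c = 4 * real (card (UNIV - {apex})) + 2"
  have top: "{x. c * x $ apex \<le> 8 * (\<Sum>i\<in>UNIV - {apex}. x $ i) + 1} =
      {x :: real ^ 'n. (c *\<^sub>R axis apex 1 - 8 *\<^sub>R (\<Sum>i\<in>UNIV - {apex}. axis i 1)) \<bullet> x \<le> 1}"
    by (simp add: inner_diff_left inner_sum_left inner_axis' algebra_simps)
  have eq: "hard_polytope = cbox 0 1 \<inter>
      (\<Inter>i\<in>UNIV - {apex}. {x. 2 * x $ i + x $ mate i \<le> 2}) \<inter>
      {x. c * x $ apex \<le> 8 * (\<Sum>i\<in>UNIV - {apex}. x $ i) + 1}"
    unfolding hard_polytope_def c_def by (auto simp: mem_box_cart)
  have "polyhedron hard_polytope"
    unfolding eq pairs top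
    by (intro polyhedron_Int polyhedron_Inter polyhedron_halfspace_le)
      (auto intro: polytope_imp_polyhedron polytope_interval polyhedron_halfspace_le)
  moreover have "bounded hard_polytope"
    by (rule bounded_subset[OF bounded_cbox[of 0 1]]) (auto simp: eq)
  ultimately show ?thesis by (simp add: polytope_eq_bounded_polyhedron)
qed

lemma convex_hard_polytope: "convex hard_polytope"
  by (rule polytope_imp_convex[OF polytope_hard_polytope])

lemma convex_pair_bound: "convex {x :: real ^ 'n. x $ i + x $ j \<le> 1}"
proof -
  have "{x :: real ^ 'n. x $ i + x $ j \<le> 1} = {x. (axis i 1 + axis j 1) \<bullet> x \<le> 1}"
    by (simp add: inner_add_left inner_axis')
  then show ?thesis by (simp add: convex_halfspace_le)
qed

lemma convex_apex_zero: "convex {x :: real ^ 'n. x $ apex = 0}"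
proof -
  have "{x :: real ^ 'n. x $ apex = 0} = {x. axis apex 1 \<bullet> x = 0}"
    by (simp add: inner_axis')
  then show ?thesis by (simp add: convex_hyperplane)
qed

section \<open>Two rounds of lift-and-project\<close>

text \<open>
  In the face \<open>x\<^sub>i = 1\<close> the constraint \<open>2 x\<^sub>i + x\<^sub>j \<le> 2\<close> forces the mate \<open>x\<^sub>j\<close> to be zero,
  and in the face \<open>x\<^sub>i = 0\<close> the pair bound is the box bound on \<open>x\<^sub>j\<close>.
\<close>

lemma lift_project_hard_polytope:
  assumes x: "x \<in> lift_project hard_polytope"
  shows "x \<in> hard_polytope" and "i \<noteq> apex \<Longrightarrow> x $ i + x $ mate i \<le> 1"
proof -
  show "x \<in> hard_polytope"
    using lift_project_subset_face_hull[OF convex_hard_polytope, of hard_polytope] x by blast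
  show "x $ i + x $ mate i \<le> 1" if "i \<noteq> apex"
  proof -
    have "lift_project hard_polytope \<subseteq> {x. x $ i + x $ mate i \<le> 1}"
    proof (rule lift_project_subset_face_hull[OF convex_pair_bound])
      fix z assume z: "z \<in> hard_polytope"
      then have "2 * z $ i + z $ mate i \<le> 2" "z $ mate i \<le> 1"
        using that unfolding hard_polytope_def by blast+
      then show "z $ i = 0 \<Longrightarrow> z \<in> {x. x $ i + x $ mate i \<le> 1}"
        and "z $ i = 1 \<Longrightarrow> z \<in> {x. x $ i + x $ mate i \<le> 1}"
        by auto
    qed
    then show ?thesis using x by blast
  qed
qed

text \<open>
  The pair bounds sum to \<open>2 S \<le> N\<close>, which contradicts the linking inequality in the face
  \<open>y = 1\<close>. The second round therefore sees only the face \<open>y = 0\<close> of the apex.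
\<close>

lemma lift_project_2_hard_polytope:
  "(lift_project ^^ 2) hard_polytope \<subseteq> pair_polytope"
proof
  fix x assume "x \<in> (lift_project ^^ 2) hard_polytope"
  then have x: "x \<in> lift_project (lift_project hard_polytope)"
    by (simp add: numeral_2_eq_2)
  have "lift_project (lift_project hard_polytope) \<subseteq> {x. x $ apex = 0}"
  proof (rule lift_project_subset_face_hull[OF convex_apex_zero])
    fix z assume z: "z \<in> lift_project hard_polytope" and one: "z $ apex = 1"
    have "2 * (\<Sum>i\<in>UNIV - {apex}. z $ i) \<le> (\<Sum>i\<in>UNIV - {apex}. 1)"
      unfolding sum_pairs by (intro sum_mono) (use lift_project_hard_polytope(2)[OF z] in auto)
    moreover have "4 * real (card (UNIV - {apex})) + 2 \<le> 8 * (\<Sum>i\<in>UNIV - {apex}. z $ i) + 1"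
      using lift_project_hard_polytope(1)[OF z] one unfolding hard_polytope_def by auto
    ultimately show "z \<in> {x. x $ apex = 0}" by simp
  qed auto
  then have "x $ apex = 0" using x by blast
  moreover have "x \<in> lift_project hard_polytope"
    using lift_project_mono[of "lift_project hard_polytope" hard_polytope]
      lift_project_hard_polytope(1) x by blast
  ultimately show "x \<in> pair_polytope"
    using lift_project_hard_polytope[of x]
    unfolding pair_polytope_def hard_polytope_def by blast
qed

text \<open>
  Integrality by rounding one pair at a time: \<open>(a, b)\<close> with \<open>a + b \<le> 1\<close> is the combination
  of \<open>(1, 0)\<close>, \<open>(0, 1)\<close> and \<open>(0, 0)\<close> with weights \<open>a\<close>, \<open>b\<close> and \<open>1 - a - b\<close>. Replacing a
  pair that has a fractional entry by these vertices lowers the number of fractional coordinates.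
\<close>

lemma pair_polytope_subset_hull:
  assumes "x \<in> pair_polytope"
  shows "x \<in> convex hull (pair_polytope \<inter> {x. \<forall>i. x $ i \<in> {0, 1}})"
  using assms
proof (induction "card {i. x $ i \<notin> {0, 1}}" arbitrary: x rule: less_induct)
  case less
  let ?H = "convex hull (pair_polytope \<inter> {x. \<forall>i. x $ i \<in> {0, 1}})"
  show ?case
  proof (cases "\<forall>i. x $ i \<in> {0, 1}")
    case True
    then show ?thesis using less.prems by (intro hull_inc) auto
  next
    case False
    then obtain i where i: "x $ i \<notin> {0, 1}" by blast
    have box: "0 \<le> x $ k" "x $ k \<le> 1" for k
      using less.prems unfolding pair_polytope_def by auto
    have pair: "x $ k + x $ mate k \<le> 1" if "k \<noteq> apex" for k
      using less.prems that unfolding pair_polytope_def by auto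
    have zero: "x $ apex = 0"
      using less.prems unfolding pair_polytope_def by auto
    have ia: "i \<noteq> apex" using i zero by auto
    define r :: "real \<Rightarrow> real \<Rightarrow> real ^ 'n" where
      "r a b = (\<chi> k. if k = i then a else if k = mate i then b else x $ k)" for a b
    have r: "r a b \<in> ?H" if ab: "a \<in> {0, 1}" "b \<in> {0, 1}" "a + b \<le> 1" for a b
    proof (rule less.hyps)
      have "{k. r a b $ k \<notin> {0, 1}} \<subset> {k. x $ k \<notin> {0, 1}}"
        using i ab by (auto simp: r_def)
      then show "card {k. r a b $ k \<notin> {0, 1}} < card {k. x $ k \<notin> {0, 1}}"
        by (intro psubset_card_mono) auto
      have "r a b $ k + r a b $ mate k \<le> 1" if "k \<noteq> apex" for k
        using that ab pair[of k] mate_neq[OF ia] by (auto simp: r_def mate_eq_iff)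
      moreover have "0 \<le> r a b $ k \<and> r a b $ k \<le> 1" for k
        using ab box[of k] by (auto simp: r_def)
      moreover have "r a b $ apex = 0"
        using ia zero by (auto simp: r_def mate_eq_iff)
      ultimately show "r a b \<in> pair_polytope"
        unfolding pair_polytope_def by auto
    qed
    have "x = x $ i *\<^sub>R r 1 0 + x $ mate i *\<^sub>R r 0 1 + (1 - x $ i - x $ mate i) *\<^sub>R r 0 0"
      using mate_neq[OF ia] by (auto simp: vec_eq_iff r_def algebra_simps)
    also have "\<dots> \<in> convex hull {r 1 0, r 0 1, r 0 0}"
      using box[of i] box[of "mate i"] pair[OF ia] unfolding convex_hull_3
      by (intro CollectI exI[of _ "x $ i"] exI[of _ "x $ mate i"]
          exI[of _ "1 - x $ i - x $ mate i"]) auto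
    also have "\<dots> \<subseteq> ?H"
      using r[of 1 0] r[of 0 1] r[of 0 0] by (intro hull_minimal) auto
    finally show ?thesis .
  qed
qed

lemma pair_polytope_subset_integer_hull: "pair_polytope \<subseteq> integer_hull hard_polytope"
proof -
  have "pair_polytope \<inter> {x. \<forall>i. x $ i \<in> {0, 1}}
      \<subseteq> hard_polytope \<inter> {x. \<forall>i. x $ i \<in> {0, 1}}"
  proof safe
    fix x assume x: "x \<in> pair_polytope" and int: "\<forall>i. x $ i \<in> {0, 1}"
    have "0 \<le> (\<Sum>i\<in>UNIV - {apex}. x $ i)"
      using x by (intro sum_nonneg) (auto simp: pair_polytope_def)
    moreover have "2 * x $ i + x $ mate i \<le> 2" if "i \<noteq> apex" for i
    proof -
      have "x $ i + x $ mate i \<le> 1" "x $ i \<le> 1"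
        using x that by (auto simp: pair_polytope_def)
      then show ?thesis by linarith
    qed
    ultimately show "x \<in> hard_polytope"
      using x unfolding hard_polytope_def pair_polytope_def by auto
  qed
  then show ?thesis
    using pair_polytope_subset_hull hull_mono unfolding integer_hull_def by blast
qed

theorem lift_project_2_eq_integer_hull:
  "(lift_project ^^ 2) hard_polytope = integer_hull hard_polytope"
  using lift_project_2_hard_polytope pair_polytope_subset_integer_hull
    integer_hull_subset_lift_project_2[of hard_polytope] by blast

section \<open>Small branch-and-bound trees\<close>

text \<open>
  The states of the adversary. Ordered by \<open>(i, mate i)\<close>, the two integral pairs are the ways in
  which a pair can keep its sum at \<open>1\<close>.
\<close>

definition adversary_point :: "real ^ 'n \<Rightarrow> bool" where
  "adversary_point p \<longleftrightarrow> p $ apex = 1 \<and>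
     (\<forall>i. i \<noteq> apex \<longrightarrow> (p $ i, p $ mate i) \<in> {(2/3, 2/3), (0, 1), (1, 0)})"

definition free :: "real ^ 'n \<Rightarrow> 'n set" where
  "free p = {i. p $ i = 2/3}"

definition fix_pair :: "'n \<Rightarrow> bool \<Rightarrow> real ^ 'n \<Rightarrow> real ^ 'n" where
  "fix_pair j b p = (\<chi> k. if k = j then of_bool b else if k = mate j then of_bool (\<not> b) else p $ k)"

lemma adversary_point_fix_pair:
  assumes "adversary_point p" "j \<noteq> apex"
  shows "adversary_point (fix_pair j b p)"
  using assms mate_neq[of j] by (auto simp: adversary_point_def fix_pair_def mate_eq_iff)

lemma adversary_point_free_mate:
  assumes "adversary_point p" "j \<in> free p"
  shows "j \<noteq> apex" "mate j \<in> free p"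
proof -
  show "j \<noteq> apex" using assms by (auto simp: adversary_point_def free_def)
  then have "(p $ j, p $ mate j) \<in> {(2/3, 2/3), (0, 1), (1, 0)}"
    using assms(1) unfolding adversary_point_def by blast
  then show "mate j \<in> free p" using assms(2) by (auto simp: free_def)
qed

lemma adversary_point_not_free:
  assumes "adversary_point p" "j \<notin> free p"
  shows "p $ j = 0 \<or> p $ j = 1"
  using assms by (cases "j = apex") (auto simp: adversary_point_def free_def)

lemma card_free_fix_pair:
  assumes "adversary_point p" "j \<in> free p"
  shows "card (free p) = card (free (fix_pair j b p)) + 2"
proof -
  have j: "j \<noteq> mate j" "mate j \<in> free p"
    using adversary_point_free_mate[OF assms] mate_neq[of j] by auto
  have "free (fix_pair j b p) = free p - {j, mate j}"
    by (auto simp: free_def fix_pair_def)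
  moreover have "card {j, mate j} \<le> card (free p)"
    using j assms(2) by (intro card_mono) auto
  ultimately show ?thesis
    using j assms(2) by (simp add: card_Diff_subset)
qed

text \<open>
  The invariant is \<open>leaves\<^sup>2 < 2 ^ free\<close>, where squaring replaces the number of free pairs by the
  number of free coordinates. Fixing a pair uses up two free coordinates, a factor \<open>4\<close> on the
  right, and passing to the child with fewer leaves pays for it with a factor of at least \<open>4\<close>
  on the left. At a leaf the left side is \<open>1\<close>, so some coordinate is still free.
\<close>

lemma small_tree_has_adversary_leaf:
  assumes "adversary_point p" "\<forall>(j, b) \<in> C. p $ j = of_bool b"
    and "(num_leaves T)\<^sup>2 < 2 ^ card (free p)"
  shows "\<exists>C' \<in> leaf_constraints C T. \<exists>q. adversary_point q \<and> free q \<noteq> {} \<and>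
           (\<forall>(j, b) \<in> C'. q $ j = of_bool b)"
  using assms
proof (induction T arbitrary: C p)
  case Leaf
  then show ?case by (intro bexI[of _ C] exI[of _ p]) auto
next
  case (Branch j t0 t1)
  \<comment> \<open>\<open>b\<close> names the child to descend to and \<open>q\<close> the adversary's point there.\<close>
  have descend: ?case
    if "adversary_point q" "\<forall>(i, c) \<in> insert (j, b) C. q $ i = of_bool c"
      "(num_leaves (if b then t1 else t0))\<^sup>2 < 2 ^ card (free q)" for q b
  proof (cases b)
    case True
    then show ?thesis using Branch.IH(2)[of q "insert (j, True) C"] that
      unfolding leaf_constraints.simps by (simp only: if_True) blast
  next
    case False
    then show ?thesis using Branch.IH(1)[of q "insert (j, False) C"] that
      unfolding leaf_constraints.simps by (simp only: if_False) blast
  qed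
  show ?case
  proof (cases "j \<in> free p")
    case False
    then obtain b where b: "p $ j = of_bool b"
      using adversary_point_not_free[OF Branch.prems(1)] by (metis of_bool_eq)
    have "(num_leaves (if b then t1 else t0))\<^sup>2 \<le> (num_leaves (Branch j t0 t1))\<^sup>2"
      by (intro power_mono) auto
    then have "(num_leaves (if b then t1 else t0))\<^sup>2 < 2 ^ card (free p)"
      using Branch.prems(3) by (rule le_less_trans)
    with b Branch.prems(1,2) show ?thesis by (intro descend[of p b]) auto
  next
    case True
    define b where "b \<longleftrightarrow> num_leaves t1 \<le> num_leaves t0"
    have "2 * num_leaves (if b then t1 else t0) \<le> num_leaves (Branch j t0 t1)"
      by (auto simp: b_def)
    then have "(2 * num_leaves (if b then t1 else t0))\<^sup>2 \<le> (num_leaves (Branch j t0 t1))\<^sup>2"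
      by (intro power_mono) auto
    then have small: "(num_leaves (if b then t1 else t0))\<^sup>2 < 2 ^ card (free (fix_pair j b p))"
      using Branch.prems(3) card_free_fix_pair[OF Branch.prems(1) True, of b]
      by (simp add: power_mult_distrib)
    \<comment> \<open>Constraints collected so far fix coordinates to integers, so none concerns a free pair.\<close>
    have "i \<noteq> j \<and> i \<noteq> mate j" if "(i, c) \<in> C" for i c
    proof -
      have "p $ i = of_bool c" using Branch.prems(2) that by blast
      then have "i \<notin> free p" by (auto simp: free_def)
      then show ?thesis using True adversary_point_free_mate[OF Branch.prems(1) True] by auto
    qed
    then have "\<forall>(i, c) \<in> insert (j, b) C. fix_pair j b p $ i = of_bool c"
      using Branch.prems(2) by (auto simp: fix_pair_def)
    with small show ?thesis
      by (intro descend[of "fix_pair j b p" b] adversary_point_fix_pair)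
        (use Branch.prems(1) adversary_point_free_mate[OF Branch.prems(1) True] in auto)
  qed
qed

text \<open>
  Every pair of an adversary point has sum at least \<open>1\<close>, and a free one has sum \<open>4/3\<close>; this
  surplus covers the excess of \<open>1/8\<close> demanded at \<open>y = 1\<close>.
\<close>

lemma adversary_point_in_hard_polytope:
  assumes p: "adversary_point p" and "free p \<noteq> {}"
  shows "p \<in> hard_polytope"
proof -
  have val: "p $ i \<in> {0, 2/3, 1}" for i
    using p by (cases "i = apex") (auto simp: adversary_point_def)
  have pairs: "2 * p $ i + p $ mate i \<le> 2" if "i \<noteq> apex" for i
    using p that unfolding adversary_point_def by fastforce
  obtain j where j: "j \<in> free p" using assms(2) by blast
  have ja: "j \<noteq> apex" using adversary_point_free_mate[OF p j] by auto
  have one: "p $ i + p $ mate i \<ge> 1" if "i \<noteq> apex" for i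
    using p that unfolding adversary_point_def by fastforce
  have pj: "p $ j + p $ mate j = 4/3"
    using adversary_point_free_mate[OF p j] j by (auto simp: free_def)
  \<comment> \<open>Counting only the surplus at the index \<open>j\<close>, and not at its mate, already suffices.\<close>
  have "real (card (UNIV - {apex})) + 1/3 = (\<Sum>i\<in>UNIV - {apex}. 1 + (if i = j then 1/3 else 0))"
    using ja by (simp add: sum.distrib)
  also have "\<dots> \<le> (\<Sum>i\<in>UNIV - {apex}. p $ i + p $ mate i)"
    using one pj by (intro sum_mono) auto
  also have "\<dots> = 2 * (\<Sum>i\<in>UNIV - {apex}. p $ i)"
    by (rule sum_pairs[symmetric])
  finally have "real (card (UNIV - {apex})) + 1/3 \<le> 2 * (\<Sum>i\<in>UNIV - {apex}. p $ i)" .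
  moreover have "p $ apex = 1" using p by (simp add: adversary_point_def)
  moreover have "0 \<le> p $ i \<and> p $ i \<le> 1" for i using val[of i] by auto
  ultimately show ?thesis using pairs unfolding hard_polytope_def by auto
qed

definition unseparated_point :: "real ^ 'n" where
  "unseparated_point = (\<chi> i. 1/4)"

lemma unseparated_point_in_hard_polytope: "unseparated_point \<in> hard_polytope"
proof -
  define N where "N = real (card (UNIV - {apex}))"
  have "(\<Sum>i\<in>UNIV - {apex}. unseparated_point $ i) = N / 4"
    unfolding unseparated_point_def vec_lambda_beta sum_constant N_def by simp
  moreover have "0 \<le> N" unfolding N_def by (rule of_nat_0_le_iff)
  ultimately show ?thesis
    unfolding hard_polytope_def N_def[symmetric] by (simp add: unseparated_point_def field_simps)
qed

lemma unseparated_point_notin_integer_hull: "unseparated_point \<notin> integer_hull hard_polytope"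
  using lift_project_2_hard_polytope
  unfolding lift_project_2_eq_integer_hull
  by (auto simp: unseparated_point_def pair_polytope_def)

text \<open>
  Solving \<open>1/4 = p / 4 + 3 w / 4\<close> for \<open>w\<close> gives \<open>w = (1 - p) / 3\<close>. At the apex this is \<open>0\<close>,
  and elsewhere it lies in \<open>[0, 1/3]\<close>, so \<open>w\<close> satisfies all pair bounds whatever the
  adversary's point \<open>p\<close> is.
\<close>

theorem unseparated_point_in_bb_relax:
  assumes "(num_leaves T)\<^sup>2 < 2 ^ card (UNIV - {apex})"
  shows "unseparated_point \<in> bb_relax T hard_polytope"
proof -
  define p0 :: "real ^ 'n" where "p0 = (\<chi> i. if i = apex then 1 else 2/3)"
  have "adversary_point p0" by (auto simp: adversary_point_def p0_def)
  moreover have "free p0 = UNIV - {apex}" by (auto simp: free_def p0_def)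
  ultimately obtain C p where C: "C \<in> leaf_constraints {} T" and p: "adversary_point p"
    "free p \<noteq> {}" and sat: "\<forall>(j, b) \<in> C. p $ j = of_bool b"
    using small_tree_has_adversary_leaf[of p0 "{}" T] assms by auto
  have "p \<in> atom hard_polytope C"
    using adversary_point_in_hard_polytope[OF p] sat by (auto simp: atom_def)
  then have p_in: "p \<in> bb_relax T hard_polytope"
    unfolding bb_relax_def using C by (intro hull_inc) auto
  define w :: "real ^ 'n" where "w = (\<chi> i. (1 - p $ i) / 3)"
  have box: "0 \<le> p $ i" "p $ i \<le> 1" for i
    using adversary_point_in_hard_polytope[OF p] by (auto simp: hard_polytope_def)
  have "w $ i + w $ mate i \<le> 1" for i
    using box[of i] box[of "mate i"] by (simp add: w_def field_simps)
  moreover have "0 \<le> w $ i \<and> w $ i \<le> 1" for i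
    using box[of i] by (simp add: w_def)
  moreover have "w $ apex = 0"
    using p by (simp add: w_def adversary_point_def)
  ultimately have "w \<in> pair_polytope"
    unfolding pair_polytope_def by auto
  then have w_in: "w \<in> bb_relax T hard_polytope"
    using pair_polytope_subset_integer_hull integer_hull_subset_bb_relax by blast
  have "unseparated_point = (1/4) *\<^sub>R p + (3/4) *\<^sub>R w"
    by (simp add: vec_eq_iff unseparated_point_def w_def field_simps)
  also have "\<dots> \<in> bb_relax T hard_polytope"
    using convexD[OF _ p_in w_in, of "1/4" "3/4"] by (simp add: bb_relax_def)
  finally show ?thesis .
qed

end

section \<open>Pairing an odd number of coordinates\<close>

lemma ex_paired_coordinates:
  assumes "odd CARD('n::finite)"
  shows "\<exists>(apex :: 'n) mate. paired_coordinates apex mate"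
proof -
  obtain h :: "'n \<Rightarrow> nat" where h: "bij_betw h UNIV {0..<CARD('n)}"
    using ex_bij_betw_finite_nat[of "UNIV :: 'n set"] finite by blast
  define g where "g = inv_into UNIV h"
  \<comment> \<open>\<open>s\<close> fixes \<open>0\<close> and swaps \<open>1\<close> with \<open>2\<close>, \<open>3\<close> with \<open>4\<close>, and so on; \<open>h\<close> transports it.\<close>
  define s :: "nat \<Rightarrow> nat" where
    "s k = (if k = 0 then 0 else if odd k then k + 1 else k - 1)" for k
  have hg: "h (g k) = k" if "k < CARD('n)" for k
    using h that by (simp add: g_def bij_betw_inv_into_right)
  have gh: "g (h i) = i" for i
    using h by (simp add: g_def bij_betw_inv_into_left)
  have hl: "h i < CARD('n)" for i
    using h by (auto simp: bij_betw_def)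
  have s_less: "s k < CARD('n)" if "k < CARD('n)" for k
  proof -
    have "k + 1 \<noteq> CARD('n)" if "odd k" using that assms by (metis even_plus_one_iff)
    then show ?thesis using that by (auto simp: s_def)
  qed
  have s_s: "s (s k) = k" for k by (auto simp: s_def)
  have s_fixed: "s k = k \<longleftrightarrow> k = 0" for k by (auto simp: s_def)
  have "paired_coordinates (g 0) (\<lambda>i. g (s (h i)))"
  proof
    fix i
    have hgs: "h (g (s (h i))) = s (h i)"
      using hl[of i] by (intro hg s_less)
    show "g (s (h (g (s (h i))))) = i"
      unfolding hgs s_s by (rule gh)
    have "g (s (h i)) = i \<longleftrightarrow> s (h i) = h i"
      using hgs gh[of i] by auto
    also have "\<dots> \<longleftrightarrow> i = g 0"
      unfolding s_fixed using gh[of i] hg[of 0] zero_less_card_finite[where 'a = 'n] by auto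
    finally show "g (s (h i)) = i \<longleftrightarrow> i = g 0" .
  qed
  then show ?thesis by blast
qed

theorem theorem7:
  fixes n :: nat
  assumes "CARD('n::finite) = n" and "6 dvd n - 1"
  shows "\<exists>P :: (real ^ 'n) set.
    polytope P \<and> P \<subseteq> {x. \<forall>i. 0 \<le> x $ i \<and> x $ i \<le> 1} \<and>
    integer_hull P = (lift_project ^^ 2) P \<and>
    (lift_project ^^ 2) P \<subset> (\<Inter>T \<in> bb_trees_leaves (2 ^ ((n - 1) div 6)). bb_relax T P) \<and>
    (\<exists>x \<in> P - integer_hull P.
       \<forall>T \<in> bb_trees. num_nodes T \<le> 2 ^ ((n - 1) div 6) \<longrightarrow> \<not> separates T P x)"
proof -
  obtain m where m: "n - 1 = 6 * m" using assms(2) by blast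
  have "0 < n" using assms(1) by (metis zero_less_card_finite)
  then have n: "n = 6 * m + 1" using m by simp
  then have "odd CARD('n)" using assms(1) by simp
  then obtain apex :: 'n and mate where "paired_coordinates apex mate"
    using ex_paired_coordinates by blast
  then interpret paired_coordinates apex mate .
  have card: "card (UNIV - {apex}) = 6 * m"
    using assms(1) n by (simp add: card_Diff_singleton)
  have small: "unseparated_point \<in> bb_relax T hard_polytope" if T: "num_leaves T \<le> 2 ^ m" for T
  proof (cases "m = 0")
    \<comment> \<open>Without pairs the adversary has nothing to play with, but the only tree is a single leaf.\<close>
    case True
    then have "T = Leaf" using T by (simp add: num_leaves_eq_1)
    then show ?thesis
      using unseparated_point_in_hard_polytope
      by (auto simp: bb_relax_def atom_def intro: hull_inc)
  next
    case False
    have "(num_leaves T)\<^sup>2 \<le> (2 ^ m)\<^sup>2" using T by (intro power_mono) auto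
    also have "\<dots> = 2 ^ (2 * m)" by (simp add: power_mult[symmetric] mult.commute)
    also have "\<dots> < 2 ^ (6 * m)" using False by (intro power_strict_increasing) auto
    finally show ?thesis using unseparated_point_in_bb_relax card by simp
  qed
  show ?thesis
  proof (intro exI[of _ hard_polytope] conjI bexI[of _ unseparated_point] ballI impI psubsetI)
    show "hard_polytope \<subseteq> {x. \<forall>i. 0 \<le> x $ i \<and> x $ i \<le> 1}"
      by (auto simp: hard_polytope_def)
    show "(lift_project ^^ 2) hard_polytope
        \<subseteq> (\<Inter>T \<in> bb_trees_leaves (2 ^ ((n - 1) div 6)). bb_relax T hard_polytope)"
      unfolding lift_project_2_eq_integer_hull using integer_hull_subset_bb_relax by blast
    have "unseparated_point
        \<in> (\<Inter>T \<in> bb_trees_leaves (2 ^ ((n - 1) div 6)). bb_relax T hard_polytope)"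
      using small n by (auto simp: bb_trees_leaves_def)
    then show "(lift_project ^^ 2) hard_polytope
        \<noteq> (\<Inter>T \<in> bb_trees_leaves (2 ^ ((n - 1) div 6)). bb_relax T hard_polytope)"
      unfolding lift_project_2_eq_integer_hull using unseparated_point_notin_integer_hull by blast
    show "\<not> separates T hard_polytope unseparated_point"
      if "num_nodes T \<le> 2 ^ ((n - 1) div 6)" for T
      using small[of T] that num_leaves_le_num_nodes[of T] n by (simp add: separates_def)
  qed (simp_all add: polytope_hard_polytope lift_project_2_eq_integer_hull
      unseparated_point_in_hard_polytope unseparated_point_notin_integer_hull)
qed

end
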